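(* The following properties are equivalent for a nonempty ultrametric space $\mathbf{M}$: (i) $\mathbf{M}$ is $T$-complete and homogeneous; (ii) $\mathbf{M}$ is $T$-complete and satisfies condition $\mathbf{h}$; (iii) $\mathbf{M}$ is isometric to $\mathbf{M}_{\mathbf{s}}(\mathrm{Well}(V))$ for some set $V$ of non-negative reals containing $0$ and some function $\mathbf{s}$ assigning to each $r\in V\setminus\{0\}$ a cardinal $\mathbf{s}(r)\ge2$.
   Context: A metric space $(M,d)$ is ultrametric if $d(x,z)\le\max\{d(x,y),d(y,z)\}$ for all $x,y,z$. It is homogeneous if every isometry between finite subsets extends to a surjective isometry of the whole space onto itself. Balls are the sets $B(a,r)=\{x:d(a,x)<r\}$ (open) and $\hat B(a,r)=\{x:d(a,x)\le r\}$ (closed), $a\in M$, $r\ge0$. An ultrametric space is $T$-complete if the intersection of every chain (with respect to inclusion) of non-empty balls is non-empty. $\mathrm{Spec}(\mathbf{M},a)=\{d(a,x):x\in M\}$; $\mathrm{Nerv}(\mathbf{M})=\{\hat B(a,r): a\in M, r\in\mathrm{Spec}(\mathbf{M},a)\}$; $\delta(B)$ is the diameter of $B$. For $B\in\mathrm{Nerv}(\mathbf{M})$ with $r=\delta(B)>0$, a son of $B$ is any open ball of radius $r$ (centered at a point of $B$) contained in $B$; $\mathrm{Sons}(B)$ is the set of sons of $B$. $\mathbf{M}$ satisfies condition $\mathbf{h}$ if it satisfies both: $(\mathbf{h_1})$ $\mathrm{Spec}(\mathbf{M},x)=\mathrm{Spec}(\mathbf{M},x')$ for all $x,x'\in M$;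 $(\mathbf{h_2})$ $|\mathrm{Sons}(B)|=|\mathrm{Sons}(B')|$ for all $B,B'\in\mathrm{Nerv}(\mathbf{M})$ with $\delta(B)=\delta(B')>0$. For $V$ and $\mathbf{s}$ as in (iii), put $V_*=V\setminus\{0\}$ and view each cardinal $\mathbf{s}(r)$ as an initial ordinal. For $f\in\prod_{r\in V_*}\mathbf{s}(r)$ the support is $\mathrm{supp}(f)=\{r\in V_*:f(r)\ne0\}$. $\mathrm{Well}(V)$ is the collection of subsets of $V_*$ that are dually well ordered (every nonempty subset has a largest element). $\mathbf{M}_{\mathbf{s}}(\mathrm{Well}(V))$ is the set of $f\in\prod_{r\in V_*}\mathbf{s}(r)$ with $\mathrm{supp}(f)\in\mathrm{Well}(V)$, with distance $d(f,f)=0$ and $d(f,g)=\max\{r\in V_*:f(r)\ne g(r)\}$ for $f\neq g$. *)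

theory Defs
  imports "HOL-Analysis.Analysis"
begin

unbundle cardinal_syntax

definition isometry_onto ::
  "'a set \<Rightarrow> ('a \<Rightarrow> 'a \<Rightarrow> real) \<Rightarrow> 'b set \<Rightarrow> ('b \<Rightarrow> 'b \<Rightarrow> real) \<Rightarrow> ('a \<Rightarrow> 'b) \<Rightarrow> bool"
  where "isometry_onto A dA B dB f \<longleftrightarrow>
    f ` A = B \<and> (\<forall>x\<in>A. \<forall>y\<in>A. dB (f x) (f y) = dA x y)"

definition isometric ::
  "'a set \<Rightarrow> ('a \<Rightarrow> 'a \<Rightarrow> real) \<Rightarrow> 'b set \<Rightarrow> ('b \<Rightarrow> 'b \<Rightarrow> real) \<Rightarrow> bool"
  where "isometric A dA B dB \<longleftrightarrow> (\<exists>f. isometry_onto A dA B dB f)"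

locale Ultrametric_space = Metric_space M d
  for M :: "'a set" and d :: "'a \<Rightarrow> 'a \<Rightarrow> real" +
  assumes ultrametric:
    "\<lbrakk>x \<in> M; y \<in> M; z \<in> M\<rbrakk> \<Longrightarrow> d x z \<le> max (d x y) (d y z)"

context Metric_space
begin

definition homogeneous :: bool
  where "homogeneous \<longleftrightarrow>
    (\<forall>A B f. finite A \<and> A \<subseteq> M \<and> finite B \<and> B \<subseteq> M \<and> isometry_onto A d B d f \<longrightarrow>
      (\<exists>g. isometry_onto M d M d g \<and> (\<forall>x\<in>A. g x = f x)))"

definition balls :: "'a set set"
  where "balls = {mball a r | a r. a \<in> M \<and> 0 \<le> r} \<union> {mcball a r | a r. a \<in> M \<and> 0 \<le> r}"

text \<open>The intersection of a chain is taken inside \<^term>\<open>M\<close>, so that the empty chain has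
  intersection \<^term>\<open>M\<close>.\<close>

definition T_complete :: bool
  where "T_complete \<longleftrightarrow>
    (\<forall>\<C>. \<C> \<subseteq> balls - {{}} \<and> chain\<^sub>\<subseteq> \<C> \<longrightarrow> M \<inter> \<Inter>\<C> \<noteq> {})"

definition Spec :: "'a \<Rightarrow> real set"
  where "Spec a = {d a x | x. x \<in> M}"

definition Nerv :: "'a set set"
  where "Nerv = {mcball a r | a r. a \<in> M \<and> r \<in> Spec a}"

definition mdiameter :: "'a set \<Rightarrow> real"
  where "mdiameter B = (SUP (x, y) \<in> B \<times> B. d x y)"

definition Sons :: "'a set \<Rightarrow> 'a set set"
  where "Sons B = {mball a (mdiameter B) | a. a \<in> B \<and> mball a (mdiameter B) \<subseteq> B}"

definition condition_h1 :: bool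
  where "condition_h1 \<longleftrightarrow> (\<forall>x\<in>M. \<forall>x'\<in>M. Spec x = Spec x')"

definition condition_h2 :: bool
  where "condition_h2 \<longleftrightarrow>
    (\<forall>B\<in>Nerv. \<forall>B'\<in>Nerv. mdiameter B = mdiameter B' \<and> mdiameter B > 0 \<longrightarrow>
      |Sons B| =o |Sons B'| )"

definition condition_h :: bool
  where "condition_h \<longleftrightarrow> condition_h1 \<and> condition_h2"

end

text \<open>A cardinal is given by a cardinal order \<open>s r\<close>, i.e. a well-order isomorphic to an initial
  ordinal. The ordinal itself is \<open>Field (s r)\<close>, and its element \<open>0\<close> is the least element.
  The values \<open>s r\<close> for \<open>r \<notin> V - {0}\<close> are irrelevant.\<close>

definition admissible :: "real set \<Rightarrow> (real \<Rightarrow> 'b rel) \<Rightarrow> bool"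
  where "admissible V s \<longleftrightarrow>
    V \<subseteq> {0..} \<and> 0 \<in> V \<and> (\<forall>r\<in>V - {0}. Card_order (s r) \<and> ctwo \<le>o s r)"

definition ord_zero :: "'b rel \<Rightarrow> 'b"
  where "ord_zero c = wo_rel.minim c (Field c)"

definition supp :: "real set \<Rightarrow> (real \<Rightarrow> 'b rel) \<Rightarrow> (real \<Rightarrow> 'b) \<Rightarrow> real set"
  where "supp V s f = {r \<in> V - {0}. f r \<noteq> ord_zero (s r)}"

definition Well :: "real set \<Rightarrow> real set set"
  where "Well V = {A. A \<subseteq> V - {0} \<and> (\<forall>S\<subseteq>A. S \<noteq> {} \<longrightarrow> (\<exists>m\<in>S. \<forall>x\<in>S. x \<le> m))}"

definition model_space :: "real set \<Rightarrow> (real \<Rightarrow> 'b rel) \<Rightarrow> (real \<Rightarrow> 'b) set"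
  where "model_space V s = {f \<in> \<Pi>\<^sub>E r\<in>V - {0}. Field (s r). supp V s f \<in> Well V}"

text \<open>The set of arguments where \<open>f\<close> and \<open>g\<close> differ may be infinite, hence
  \<^const>\<open>Greatest\<close> instead of \<^const>\<open>Max\<close>. On \<^const>\<open>model_space\<close> it exists for distinct
  functions, because that set is contained in the union of the two supports.\<close>

definition model_dist :: "real set \<Rightarrow> (real \<Rightarrow> 'b) \<Rightarrow> (real \<Rightarrow> 'b) \<Rightarrow> real"
  where "model_dist V f g =
    (if f = g then 0 else (GREATEST r. r \<in> V - {0} \<and> f r \<noteq> g r))"

text \<open>The cardinals \<open>s r\<close> live on subsets of a fixed type \<open>'b\<close>, as HOL cannot quantify over
  types inside a formula. Each \<open>s r\<close> embeds into \<^const>\<open>model_space\<close> as the functions with support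
  contained in \<open>{r}\<close>, hence into any space \<open>M :: 'a set\<close> isometric to it, so \<open>'b = 'a\<close> already
  covers all cardinals that can occur.\<close>

definition isometric_to_model ::
  "'b itself \<Rightarrow> 'a set \<Rightarrow> ('a \<Rightarrow> 'a \<Rightarrow> real) \<Rightarrow> bool"
  where "isometric_to_model _ M d \<longleftrightarrow>
    (\<exists>(V :: real set) (s :: real \<Rightarrow> 'b rel).
      admissible V s \<and> isometric M d (model_space V s) (model_dist V))"

end

theory Submission
  imports Defs
begin

text \<open>
  A homogeneous space satisfies condition h because an isometry carrying one point to another maps
  the sons of a ball around the first bijectively to those of the ball around the second.

  Under condition h, label the sons of each ball of diameter \<open>r\<close> bijectively by \<open>s r\<close> and send
  a point to the family of labels of the sons that contain it; the distance of two points is the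
  largest radius at which their labels differ. If the label \<open>0\<close> marks the son containing the
  least element of the ball in a fixed well-order, the supports are dually well ordered, and
  \<open>T\<close>-completeness makes this embedding surjective.

  Conversely, in the model space the coordinates shared by the balls of a chain, extended by \<open>0\<close>,
  define a common point. Transposing \<open>a t\<close> and \<open>b t\<close> in each coordinate \<open>t\<close> is an isometry
  exchanging \<open>a\<close> and \<open>b\<close>, and restricting such exchanges extends finite isometries one
  point at a time.
\<close>

section \<open>Isometries and bijections\<close>

lemma isometry_onto_comp:
  "isometry_onto A dA B dB f \<Longrightarrow> isometry_onto B dB C dC g \<Longrightarrow> isometry_onto A dA C dC (g \<circ> f)"
  unfolding isometry_onto_def image_comp [symmetric] o_apply by (metis imageI)

lemma (in Metric_space) isometry_onto_inj_on:
  assumes "isometry_onto M d B dB f" "\<And>z. z \<in> B \<Longrightarrow> dB z z = 0"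
  shows "inj_on f M"
  using assms unfolding isometry_onto_def inj_on_def by (metis imageI zero)

lemma (in Metric_space) isometry_onto_inv_into:
  assumes f: "isometry_onto M d B dB f" and "inj_on f M"
  shows "isometry_onto B dB M d (inv_into M f)"
  using assms unfolding isometry_onto_def
  by (smt (verit) f_inv_into_f inv_into_image_cancel inv_into_into subset_refl)

text \<open>Used to normalise a labelling of sons so that a chosen son gets the label zero: a
  transposition of the target corrects the one value.\<close>

lemma bij_betw_prescribe_value:
  assumes "bij_betw f A B" "a \<in> A" "b \<in> B"
  obtains g where "bij_betw g A B" "g a = b"
proof
  have "f a \<in> B" using assms by (auto simp: bij_betw_def)
  then have "bij_betw (Transposition.transpose (f a) b) B B"
    using assms(3) by simp
  with assms(1) show "bij_betw (Transposition.transpose (f a) b \<circ> f) A B"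
    by (rule bij_betw_trans)
  show "(Transposition.transpose (f a) b \<circ> f) a = b" by simp
qed

section \<open>Balls and sons in an ultrametric space\<close>

context Ultrametric_space
begin

lemma mball_eq_iff:
  assumes "x \<in> M" "y \<in> M" "0 < r"
  shows "mball x r = mball y r \<longleftrightarrow> d x y < r"
proof
  assume "mball x r = mball y r"
  moreover have "y \<in> mball y r" using assms by simp
  ultimately show "d x y < r" by auto
next
  assume "d x y < r"
  then show "mball x r = mball y r"
    using ultrametric [OF assms(1,2)] ultrametric [OF assms(2,1)] assms commute [of x y]
    by (fastforce simp: max_def split: if_splits)
qed

lemma mcball_eq_iff:
  assumes "x \<in> M" "y \<in> M" "0 \<le> r"
  shows "mcball x r = mcball y r \<longleftrightarrow> d x y \<le> r"
proof
  assume "mcball x r = mcball y r"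
  moreover have "y \<in> mcball y r" using assms by simp
  ultimately show "d x y \<le> r" by auto
next
  assume "d x y \<le> r"
  then show "mcball x r = mcball y r"
    using ultrametric [OF assms(1,2)] ultrametric [OF assms(2,1)] assms commute [of x y]
    by (fastforce simp: max_def split: if_splits)
qed

text \<open>The ultrametric inequality bounds all distances in the ball by its radius, and the bound
  is attained from the centre because \<open>r\<close> lies in the spectrum.\<close>

lemma mdiameter_mcball:
  assumes "a \<in> M" "r \<in> Spec a"
  shows "mdiameter (mcball a r) = r"
  unfolding mdiameter_def
proof (rule cSup_eq_maximum)
  obtain b where b: "b \<in> M" "d a b = r" using assms by (auto simp: Spec_def)
  then have "a \<in> mcball a r" "b \<in> mcball a r" using assms nonneg [of a b] by auto
  with b show "r \<in> (\<lambda>(x, y). d x y) ` (mcball a r \<times> mcball a r)"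
    by force
  fix t assume "t \<in> (\<lambda>(x, y). d x y) ` (mcball a r \<times> mcball a r)"
  then obtain x y where "t = d x y" "x \<in> mcball a r" "y \<in> mcball a r" by auto
  then show "t \<le> r"
    using ultrametric [of x a y] commute [of a x] by auto
qed

text \<open>By the ultrametric inequality, the open ball of radius \<open>r\<close> around any point
  of the closed ball stays inside it, so every point determines a son.\<close>

lemma Sons_mcball:
  assumes "a \<in> M" "r \<in> Spec a" "0 < r"
  shows "Sons (mcball a r) = (\<lambda>x. mball x r) ` mcball a r"
proof -
  have "mball x r \<subseteq> mcball a r" if "x \<in> mcball a r" for x
    using that ultrametric [of a x] by fastforce
  then show ?thesis
    unfolding Sons_def mdiameter_mcball [OF assms(1,2)] by blast
qed

lemma isometry_image_mball:
  assumes "isometry_onto M d M d g" "a \<in> M"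
  shows "g ` mball a r = mball (g a) r" "g ` mcball a r = mcball (g a) r"
proof -
  have gM: "g ` M = M" and gd: "\<And>x y. x \<in> M \<Longrightarrow> y \<in> M \<Longrightarrow> d (g x) (g y) = d x y"
    using assms by (auto simp: isometry_onto_def)
  \<comment> \<open>An arbitrary predicate on the distance to the centre covers open and closed
    balls at once.\<close>
  have "g ` {x \<in> M. P (d a x)} = {y \<in> M. P (d (g a) y)}" for P
  proof -
    have "{y \<in> M. P (d (g a) y)} = {y \<in> g ` M. P (d (g a) y)}" by (simp add: gM)
    also have "\<dots> = g ` {x \<in> M. P (d a x)}" using gd assms(2) by (auto intro!: imageI)
    finally show ?thesis ..
  qed
  moreover have "g a \<in> M" using gM assms(2) by blast
  ultimately show "g ` mball a r = mball (g a) r" "g ` mcball a r = mcball (g a) r"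
    using assms(2) by (simp_all add: mball_def mcball_def)
qed

section \<open>Homogeneity, condition h and the extension of finite isometries\<close>

lemma homogeneous_transitive:
  assumes homogeneous "a \<in> M" "b \<in> M"
  shows "\<exists>g. isometry_onto M d M d g \<and> g a = b"
proof -
  have "isometry_onto {a} d {b} d (\<lambda>_. b)"
    using assms by (simp add: isometry_onto_def)
  then have "\<exists>g. isometry_onto M d M d g \<and> (\<forall>x\<in>{a}. g x = b)"
    using assms unfolding homogeneous_def
    by (elim allE [of _ "{a}"] allE [of _ "{b}"] allE [of _ "\<lambda>_. b"]) auto
  then show ?thesis by auto
qed

lemma homogeneous_imp_condition_h:
  assumes homogeneous
  shows condition_h
proof -
  have "Spec a \<subseteq> Spec b" if ab: "a \<in> M" "b \<in> M" for a b
  proof -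
    obtain g where "isometry_onto M d M d g" "g a = b"
      using homogeneous_transitive [OF assms ab] by blast
    then show ?thesis
      using ab unfolding Spec_def isometry_onto_def by auto (metis imageI)
  qed
  then have condition_h1 unfolding condition_h1_def by blast
  moreover have condition_h2 unfolding condition_h2_def
  proof (intro ballI impI)
    fix B B' assume "B \<in> Nerv" "B' \<in> Nerv" and diam: "mdiameter B = mdiameter B' \<and> mdiameter B > 0"
    then obtain a r a' r' where a: "B = mcball a r" "a \<in> M" "r \<in> Spec a"
      and a': "B' = mcball a' r'" "a' \<in> M" "r' \<in> Spec a'"
      by (auto simp: Nerv_def)
    with diam have r: "r' = r" "0 < r" by (auto simp: mdiameter_mcball)
    obtain g where g: "isometry_onto M d M d g" "g a = a'"
      using homogeneous_transitive [OF assms a(2) a'(2)] by blast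
    have "inj_on g M" using isometry_onto_inj_on [OF g(1)] by simp
    \<comment> \<open>The bijection between the sons is induced by \<open>g\<close>, acting on
      subsets by taking images.\<close>
    then have "inj_on ((`) g) (Sons B)"
      by (rule inj_on_subset [OF inj_on_image_Pow]) (auto simp: Sons_def)
    moreover have "(`) g ` Sons B = Sons B'"
    proof -
      have "(`) g ` Sons B = (\<lambda>x. mball (g x) r) ` mcball a r"
        unfolding a(1) Sons_mcball [OF a(2,3) r(2)] image_image
        by (intro image_cong refl isometry_image_mball g) auto
      also have "\<dots> = (\<lambda>x. mball x r) ` (g ` mcball a r)" by (simp add: image_image)
      also have "\<dots> = Sons B'"
        using a' r g(2) by (simp add: isometry_image_mball [OF g(1) a(2)] Sons_mcball)
      finally show ?thesis .
    qed
    ultimately show "|Sons B| =o |Sons B'|"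
      by (intro card_of_ordIsoI) (rule bij_betw_imageI)
  qed
  ultimately show ?thesis by (simp add: condition_h_def)
qed

text \<open>Restricting the exchange of \<open>a\<close> and \<open>b\<close> to the two open balls of radius \<open>d a b\<close> around
  them gives an isometry that fixes every point outside these balls.\<close>

lemma exchange_fixing:
  assumes ab: "a \<in> M" "b \<in> M" and \<sigma>: "isometry_onto M d M d \<sigma>" "\<sigma> a = b" "\<sigma> b = a"
    and C: "C \<subseteq> M" "\<And>c. c \<in> C \<Longrightarrow> d a c = d b c"
  obtains h where "isometry_onto M d M d h" "h a = b" "\<And>c. c \<in> C \<Longrightarrow> h c = c"
proof (cases "a = b")
  case True
  with that [of id] show ?thesis by (simp add: isometry_onto_def)
next
  case False
  define r where "r = d a b"
  have r: "0 < r" using False ab by (simp add: r_def)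
  define U where "U = mball a r \<union> mball b r"
  define h where "h x = (if x \<in> U then \<sigma> x else x)" for x
  have \<sigma>M: "\<sigma> x \<in> M" if "x \<in> M" for x using that \<sigma>(1) by (auto simp: isometry_onto_def)
  have \<sigma>d: "d (\<sigma> x) (\<sigma> y) = d x y" if "x \<in> M" "y \<in> M" for x y
    using that \<sigma>(1) by (auto simp: isometry_onto_def)
  \<comment> \<open>\<open>\<sigma>\<close> maps the two balls onto each other, hence preserves
    their union.\<close>
  have \<sigma>U: "\<sigma> ` U = U"
    using isometry_image_mball(1) [OF \<sigma>(1) ab(1)] isometry_image_mball(1) [OF \<sigma>(1) ab(2)] \<sigma>
    by (auto simp: U_def image_Un)
  have UM: "U \<subseteq> M" by (auto simp: U_def)
  have U_close: "d x y \<le> r" if "x \<in> U" "y \<in> U" for x y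
  proof -
    have "d a z \<le> r" if "z \<in> U" for z
      using that ab ultrametric [of a b z] by (auto simp: U_def r_def)
    from this [OF that(1)] this [OF that(2)] have "max (d x a) (d a y) \<le> r"
      by (simp add: commute [of x a])
    moreover have "d x y \<le> max (d x a) (d a y)"
      using that UM ab by (intro ultrametric) auto
    ultimately show ?thesis by linarith
  qed
  have U_far: "r \<le> d x y" if "x \<in> U" "y \<in> M - U" for x y
  proof -
    have "y \<in> U" if "d x y < r"
      using that \<open>x \<in> U\<close> \<open>y \<in> M - U\<close> ultrametric [of a x y] ultrametric [of b x y] ab
      by (auto simp: U_def)
    then show ?thesis using that by fastforce
  qed
  \<comment> \<open>Both \<open>x\<close> and \<open>\<sigma> x\<close> are at distance at least
    \<open>r\<close> from \<open>y\<close> but at most \<open>r\<close> from each other, so the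
    ultrametric inequality makes their distances to \<open>y\<close> equal.\<close>
  have mixed: "d (\<sigma> x) y = d x y" if "x \<in> U" "y \<in> M - U" for x y
  proof -
    have \<sigma>x: "\<sigma> x \<in> U" using \<sigma>U that by auto
    have "r \<le> d x y" "r \<le> d (\<sigma> x) y" "d x (\<sigma> x) \<le> r"
      using U_far U_close that \<sigma>x by auto
    moreover have "d x y \<le> max (d x (\<sigma> x)) (d (\<sigma> x) y)" "d (\<sigma> x) y \<le> max (d (\<sigma> x) x) (d x y)"
      using ultrametric that \<sigma>x UM by auto
    ultimately show ?thesis using commute [of x "\<sigma> x"] by auto
  qed
  have "d (h x) (h y) = d x y" if "x \<in> M" "y \<in> M" for x y
    using that mixed [of x y] mixed [of y x] commute \<sigma>d by (auto simp: h_def)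
  moreover have "h ` M = M"
  proof -
    have "h ` M = h ` U \<union> h ` (M - U)" using UM by blast
    also have "h ` U = U" using \<sigma>U by (simp add: h_def)
    also have "h ` (M - U) = M - U" by (simp add: h_def)
    finally show ?thesis using UM by blast
  qed
  ultimately have "isometry_onto M d M d h" by (simp add: isometry_onto_def)
  moreover have "h a = b" using ab r \<sigma> by (simp add: h_def U_def)
  moreover have "h c = c" if c: "c \<in> C" for c
  proof -
    \<comment> \<open>As \<open>c\<close> is equidistant from \<open>a\<close> and \<open>b\<close>,
      the inequality for \<open>r = d a b\<close> through \<open>c\<close> puts \<open>c\<close>
      outside both open balls.\<close>
    have "r \<le> d a c" "r \<le> d b c"
      using ultrametric [of a c b] C(2) [OF c] subsetD [OF C(1) c] ab commute [of c b]
      by (simp_all add: r_def)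
    then show ?thesis by (auto simp: h_def U_def)
  qed
  ultimately show ?thesis using that by blast
qed

lemma homogeneous_if_exchange:
  assumes exch: "\<And>a b. a \<in> M \<Longrightarrow> b \<in> M \<Longrightarrow> \<exists>\<sigma>. isometry_onto M d M d \<sigma> \<and> \<sigma> a = b \<and> \<sigma> b = a"
  shows homogeneous
proof -
  have ext: "\<exists>g. isometry_onto M d M d g \<and> (\<forall>x\<in>A. g x = f x)"
    if "finite A" "A \<subseteq> M" "f ` A \<subseteq> M" "\<And>x y. x \<in> A \<Longrightarrow> y \<in> A \<Longrightarrow> d (f x) (f y) = d x y" for A f
    using that
  proof (induction A)
    case empty
    have "isometry_onto M d M d id" by (simp add: isometry_onto_def)
    then show ?case by blast
  next
    case (insert a A)
    then obtain g where g: "isometry_onto M d M d g" "\<And>x. x \<in> A \<Longrightarrow> g x = f x"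
      by (auto)
    have ga: "g a \<in> M" using g(1) insert.prems by (auto simp: isometry_onto_def)
    have fa: "f a \<in> M" using insert.prems by auto
    obtain \<sigma> where \<sigma>: "isometry_onto M d M d \<sigma>" "\<sigma> (g a) = f a" "\<sigma> (f a) = g a"
      using exch [OF ga fa] by blast
    have eq: "d (g a) c = d (f a) c" if c: "c \<in> f ` A" for c
    proof -
      obtain x where x: "x \<in> A" "c = f x" using c by auto
      then have "d (g a) (g x) = d a x" using g(1) insert.prems by (auto simp: isometry_onto_def)
      also have "\<dots> = d (f a) (f x)" using insert.prems x by auto
      finally show ?thesis using g x by simp
    qed
    obtain h where h: "isometry_onto M d M d h" "h (g a) = f a" "\<And>c. c \<in> f ` A \<Longrightarrow> h c = c"
      using exchange_fixing [OF ga fa \<sigma> _ eq] insert.prems by auto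
    have "isometry_onto M d M d (h \<circ> g)" using isometry_onto_comp g(1) h(1) .
    moreover have "\<forall>x\<in>insert a A. (h \<circ> g) x = f x" using g(2) h by auto
    ultimately show ?case by blast
  qed
  show ?thesis
    unfolding homogeneous_def
  proof (intro allI impI, elim conjE)
    fix A B f assume "finite A" "A \<subseteq> M" "B \<subseteq> M" "isometry_onto A d B d f"
    then show "\<exists>g. isometry_onto M d M d g \<and> (\<forall>x\<in>A. g x = f x)"
      by (intro ext) (simp_all add: isometry_onto_def)
  qed
qed

end

section \<open>Dually well-ordered sets and the model space\<close>

lemma Well_subset: "A \<in> Well V \<Longrightarrow> B \<subseteq> A \<Longrightarrow> B \<in> Well V"
  unfolding Well_def by auto

lemma WellD:
  assumes "S \<subseteq> A" "A \<in> Well V" "S \<noteq> {}"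
  obtains m where "m \<in> S" "\<And>x. x \<in> S \<Longrightarrow> x \<le> m"
proof -
  have "\<exists>m\<in>S. \<forall>x\<in>S. x \<le> m" using assms by (simp add: Well_def)
  then show ?thesis using that by auto
qed

lemma Well_Un:
  assumes "A \<in> Well V" "B \<in> Well V"
  shows "A \<union> B \<in> Well V"
proof -
  have "\<exists>m\<in>S. \<forall>x\<in>S. x \<le> m" if S: "S \<subseteq> A \<union> B" "S \<noteq> {}" for S
  proof (cases "S \<inter> A = {} \<or> S \<inter> B = {}")
    case True
    then have "S \<subseteq> A \<or> S \<subseteq> B" using S by blast
    then show ?thesis using S(2) WellD [OF _ assms(1)] WellD [OF _ assms(2)] by metis
  next
    case False
    obtain m where m: "m \<in> S \<inter> A" "\<And>x. x \<in> S \<inter> A \<Longrightarrow> x \<le> m"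
      by (rule WellD [OF Int_lower2 assms(1)]) (use False in auto)
    obtain n where n: "n \<in> S \<inter> B" "\<And>x. x \<in> S \<inter> B \<Longrightarrow> x \<le> n"
      by (rule WellD [OF Int_lower2 assms(2)]) (use False in auto)
    have "x \<le> max m n" if "x \<in> S" for x
      using that S m(2) [of x] n(2) [of x] by (auto simp: le_max_iff_disj)
    moreover have "max m n \<in> S" using m n by (simp add: max_def)
    ultimately show ?thesis by blast
  qed
  moreover have "A \<union> B \<subseteq> V - {0}" using assms by (simp add: Well_def)
  ultimately show ?thesis by (simp add: Well_def)
qed

text \<open>Turns the cardinal bound into two distinct labels, the form in which admissibility is
  used and verified.\<close>

lemma ctwo_ordLeq_iff:
  assumes "Card_order r"
  shows "ctwo \<le>o r \<longleftrightarrow> (\<exists>p\<in>Field r. \<exists>q\<in>Field r. p \<noteq> q)"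
proof -
  have "ctwo \<le>o r \<longleftrightarrow> |UNIV :: bool set| \<le>o |Field r|"
    unfolding ctwo_def
    using card_of_Field_ordIso [OF assms] ordLeq_ordIso_trans ordIso_symmetric by blast
  also have "\<dots> \<longleftrightarrow> (\<exists>f :: bool \<Rightarrow> _. inj f \<and> range f \<subseteq> Field r)"
    by (simp add: card_of_ordLeq [symmetric])
  also have "\<dots> \<longleftrightarrow> (\<exists>p\<in>Field r. \<exists>q\<in>Field r. p \<noteq> q)"
  proof
    assume "\<exists>f :: bool \<Rightarrow> _. inj f \<and> range f \<subseteq> Field r"
    then obtain f :: "bool \<Rightarrow> _" where "inj f" "range f \<subseteq> Field r" by blast
    then have "f True \<noteq> f False" "f True \<in> Field r" "f False \<in> Field r"
      by (auto dest: injD)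
    then show "\<exists>p\<in>Field r. \<exists>q\<in>Field r. p \<noteq> q" by blast
  next
    assume "\<exists>p\<in>Field r. \<exists>q\<in>Field r. p \<noteq> q"
    then obtain p q where "p \<in> Field r" "q \<in> Field r" "p \<noteq> q" by blast
    then have "inj (\<lambda>b. if b then p else q)" "range (\<lambda>b. if b then p else q) \<subseteq> Field r"
      by (auto simp: inj_def)
    then show "\<exists>f :: bool \<Rightarrow> _. inj f \<and> range f \<subseteq> Field r" by blast
  qed
  finally show ?thesis .
qed

lemma ord_zero_in_Field:
  assumes "Card_order r" "Field r \<noteq> {}"
  shows "ord_zero r \<in> Field r"
  using assms unfolding ord_zero_def
  by (intro wo_rel.minim_in) (auto simp: wo_rel_def card_order_on_well_order_on)

lemma model_dist_eqI:
  assumes "m \<in> V - {0}" "f m \<noteq> g m" "\<And>t. t \<in> V - {0} \<Longrightarrow> m < t \<Longrightarrow> f t = g t"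
  shows "model_dist V f g = m"
proof -
  have "(GREATEST r. r \<in> V - {0} \<and> f r \<noteq> g r) = m"
    using assms by (intro Greatest_equality) (auto simp: not_less [symmetric])
  then show ?thesis using assms(2) by (auto simp: model_dist_def)
qed

text \<open>Where \<open>f\<close> and \<open>g\<close> differ, one of them is nonzero; so the set
  of differences lies in the union of two dually well-ordered supports and has a largest
  element.\<close>

lemma model_space_greatest_difference:
  assumes "f \<in> model_space V s" "g \<in> model_space V s" "f \<noteq> g"
  obtains m where "m \<in> V - {0}" "f m \<noteq> g m" "\<And>t. t \<in> V - {0} \<Longrightarrow> m < t \<Longrightarrow> f t = g t"
    "model_dist V f g = m"
proof -
  define D where "D = {r \<in> V - {0}. f r \<noteq> g r}"
  have "supp V s f \<union> supp V s g \<in> Well V"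
    using assms by (intro Well_Un) (auto simp: model_space_def)
  moreover have "D \<subseteq> supp V s f \<union> supp V s g" by (auto simp: D_def supp_def)
  ultimately have "D \<in> Well V" by (rule Well_subset)
  moreover have "D \<noteq> {}"
    using assms PiE_ext [of f "V - {0}" "\<lambda>r. Field (s r)" g]
    by (auto simp: D_def model_space_def)
  ultimately obtain m where "m \<in> D" "\<And>t. t \<in> D \<Longrightarrow> t \<le> m" using WellD [OF order_refl] by metis
  then have m: "m \<in> V - {0}" "f m \<noteq> g m" "\<And>t. t \<in> V - {0} \<Longrightarrow> m < t \<Longrightarrow> f t = g t"
    by (auto simp: D_def not_le [symmetric])
  then have "model_dist V f g = m" by (intro model_dist_eqI)
  with that [OF m] show ?thesis by blast
qed

lemma model_space_agree_above:
  assumes "f \<in> model_space V s" "g \<in> model_space V s" "t \<in> V - {0}" "model_dist V f g < t"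
  shows "f t = g t"
  using model_space_greatest_difference [OF assms(1,2)] assms(3,4) by metis

lemma model_space_exchange:
  assumes a: "a \<in> model_space V s" and b: "b \<in> model_space V s"
  obtains \<tau> where
    "isometry_onto (model_space V s) (model_dist V) (model_space V s) (model_dist V) \<tau>"
    "\<tau> a = b" "\<tau> b = a"
proof -
  define \<tau> where "\<tau> u = (\<lambda>t\<in>V - {0}. Transposition.transpose (a t) (b t) (u t))" for u
  have \<tau>_in: "\<tau> u \<in> model_space V s" if u: "u \<in> model_space V s" for u
  proof -
    \<comment> \<open>Where \<open>u\<close>, \<open>a\<close> and \<open>b\<close> all vanish, the
      transposition is trivial and \<open>\<tau> u\<close> vanishes too.\<close>
    have "supp V s (\<tau> u) \<subseteq> supp V s u \<union> (supp V s a \<union> supp V s b)"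
      by (auto simp: supp_def \<tau>_def)
    moreover have "supp V s u \<union> (supp V s a \<union> supp V s b) \<in> Well V"
      using a b u by (intro Well_Un) (auto simp: model_space_def)
    ultimately have "supp V s (\<tau> u) \<in> Well V" using Well_subset by blast
    moreover have "\<tau> u \<in> (\<Pi>\<^sub>E r\<in>V - {0}. Field (s r))"
      using a b u by (auto simp: \<tau>_def model_space_def Transposition.transpose_def PiE_iff)
    ultimately show ?thesis by (simp add: model_space_def)
  qed
  have \<tau>\<tau>: "\<tau> (\<tau> u) = u" if "u \<in> model_space V s" for u
    using that by (auto simp: \<tau>_def model_space_def fun_eq_iff PiE_def extensional_def)
  have "\<tau> ` model_space V s = model_space V s"
    using \<tau>_in \<tau>\<tau> by (metis image_subsetI subsetI image_eqI subset_antisym)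
  moreover have "model_dist V (\<tau> u) (\<tau> v) = model_dist V u v"
    if "u \<in> model_space V s" "v \<in> model_space V s" for u v
  proof -
    \<comment> \<open>Transpositions are injective, so \<open>\<tau>\<close> preserves the exact set
      of coordinates at which two families differ.\<close>
    have "\<tau> u = \<tau> v \<longleftrightarrow> u = v" using that \<tau>\<tau> by metis
    moreover have "(r \<in> V - {0} \<and> \<tau> u r \<noteq> \<tau> v r) \<longleftrightarrow> (r \<in> V - {0} \<and> u r \<noteq> v r)" for r
      by (auto simp: \<tau>_def dest: injD [OF inj_transpose])
    ultimately show ?thesis by (simp only: model_dist_def)
  qed
  moreover have "\<tau> a = b" "\<tau> b = a"
    using a b by (auto simp: \<tau>_def model_space_def fun_eq_iff PiE_def extensional_def)
  ultimately show ?thesis by (intro that [of \<tau>]) (simp_all add: isometry_onto_def)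
qed

section \<open>From the model space back to homogeneity and completeness\<close>

context Ultrametric_space
begin

text \<open>Treats open and closed balls alike: the distance from the centre to \<open>w\<close> is
  at most the largest of the distances from the centre to \<open>x\<close>, \<open>y\<close> and
  \<open>z\<close>.\<close>

lemma balls_memI:
  assumes "B \<in> balls" "x \<in> B" "y \<in> B" "z \<in> B" "w \<in> M" "d x w \<le> d y z"
  shows "w \<in> B"
proof -
  have "d a w \<le> max (d a x) (max (d a y) (d a z))" if "a \<in> M" "x \<in> M" "y \<in> M" "z \<in> M" for a
    using ultrametric [of a x w] ultrametric [of y a z] commute [of y a] that assms(5,6) by auto
  then show ?thesis
    using assms unfolding balls_def by fastforce
qed

lemma model_imp_homogeneous:
  assumes L: "isometry_onto M d (model_space V s) (model_dist V) L"
  shows homogeneous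
proof (rule homogeneous_if_exchange)
  have inj: "inj_on L M"
    using isometry_onto_inj_on [OF L] by (simp add: model_dist_def)
  fix a b assume ab: "a \<in> M" "b \<in> M"
  then have Lab: "L a \<in> model_space V s" "L b \<in> model_space V s"
    using L by (auto simp: isometry_onto_def)
  obtain \<tau> where \<tau>:
    "isometry_onto (model_space V s) (model_dist V) (model_space V s) (model_dist V) \<tau>"
    "\<tau> (L a) = L b" "\<tau> (L b) = L a"
    using model_space_exchange [OF Lab] by blast
  \<comment> \<open>The exchange in the model is conjugated by \<open>L\<close>.\<close>
  let ?\<sigma> = "inv_into M L \<circ> (\<tau> \<circ> L)"
  have "isometry_onto M d M d ?\<sigma>"
    by (intro isometry_onto_comp [OF isometry_onto_comp [OF L \<tau>(1)]] isometry_onto_inv_into L inj)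
  moreover have "?\<sigma> a = b" "?\<sigma> b = a" using \<tau> ab inj by auto
  ultimately show "\<exists>\<sigma>. isometry_onto M d M d \<sigma> \<and> \<sigma> a = b \<and> \<sigma> b = a" by blast
qed

lemma model_imp_T_complete:
  assumes adm: "admissible V s" and L: "isometry_onto M d (model_space V s) (model_dist V) L"
  shows T_complete
  unfolding T_complete_def
proof (intro allI impI, elim conjE)
  fix \<C> assume \<C>: "\<C> \<subseteq> balls - {{}}" and chain: "chain\<^sub>\<subseteq> \<C>"
  have L_in: "L x \<in> model_space V s" if "x \<in> M" for x
    using that L by (auto simp: isometry_onto_def)
  have L_dist: "model_dist V (L x) (L y) = d x y" if "x \<in> M" "y \<in> M" for x y
    using that L by (auto simp: isometry_onto_def)
  have BM: "B \<subseteq> M" if "B \<in> \<C>" for B using that \<C> by (auto simp: balls_def)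
  text \<open>For \<open>t \<in> T B\<close>, all coordinates from \<open>t\<close> upwards are constant on \<open>B\<close>.\<close>
  define T where "T B = {t \<in> V - {0}. \<forall>x\<in>B. \<forall>y\<in>B. d x y < t}" for B
  \<comment> \<open>\<open>P t v\<close> says that some ball of the chain is small enough to
    determine coordinate \<open>t\<close>, and that its value there is \<open>v\<close>.\<close>
  define P where "P t v \<longleftrightarrow> (\<exists>B\<in>\<C>. t \<in> T B \<and> (\<exists>x\<in>B. v = L x t))" for t v
  \<comment> \<open>Coordinates that no ball of the chain determines get the value zero.\<close>
  define f where
    "f = (\<lambda>t\<in>V - {0}. if \<exists>v. P t v then SOME v. P t v else ord_zero (s t))"
  \<comment> \<open>The value does not depend on the ball: two balls of the chain are nested, so
    points of both lie in the larger one, whose distances are still below \<open>t\<close>.\<close>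
  have f_eq: "f t = L x t" if B: "B \<in> \<C>" and t: "t \<in> T B" and x: "x \<in> B" for B t x
  proof -
    have tV: "t \<in> V - {0}" using t by (simp add: T_def)
    have "P t (L x t)" using that by (auto simp: P_def)
    then have "P t (f t)" using tV by (auto simp: f_def intro: someI)
    then obtain B' x' where B': "B' \<in> \<C>" "t \<in> T B'" "x' \<in> B'" "f t = L x' t"
      by (auto simp: P_def)
    have "B \<subseteq> B' \<or> B' \<subseteq> B" using chain B B'(1) by (auto simp: chain_subset_def)
    then have "d x x' < t" using B' t x by (auto simp: T_def)
    moreover have "x \<in> M" "x' \<in> M" using BM B B' x by auto
    ultimately show ?thesis
      using model_space_agree_above [OF L_in L_in tV] L_dist B'(4) by metis
  qed
  have "f \<in> model_space V s"
  proof -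
    have "f t \<in> Field (s t)" if t: "t \<in> V - {0}" for t
    proof (cases "\<exists>v. P t v")
      case True
      then obtain B x where B: "B \<in> \<C>" "t \<in> T B" "x \<in> B" by (auto simp: P_def)
      then have "L x \<in> model_space V s" using BM L_in by blast
      then show ?thesis using f_eq [OF B] t by (auto simp: model_space_def)
    next
      case False
      have "Card_order (s t)" "ctwo \<le>o s t" using adm t by (auto simp: admissible_def)
      then have "ord_zero (s t) \<in> Field (s t)"
        using ctwo_ordLeq_iff by (intro ord_zero_in_Field) auto
      then show ?thesis using False t by (simp only: f_def restrict_apply' if_False)
    qed
    moreover have "supp V s f \<in> Well V"
      unfolding Well_def
    proof (intro CollectI conjI allI impI)
      show "supp V s f \<subseteq> V - {0}" by (auto simp: supp_def)
      fix S assume S: "S \<subseteq> supp V s f" "S \<noteq> {}"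
      then obtain u where u: "u \<in> S" by blast
      then have uV: "u \<in> V - {0}" and "f u \<noteq> ord_zero (s u)" using S by (auto simp: supp_def)
      then have "\<exists>v. P u v" by (auto simp: f_def split: if_splits)
      then obtain B x where B: "B \<in> \<C>" "u \<in> T B" "x \<in> B" by (auto simp: P_def)
      \<comment> \<open>From \<open>u\<close> upwards \<open>f\<close> has the coordinates of
        \<open>L x\<close>, so this part of \<open>S\<close> has a maximum, which is then the
        maximum of \<open>S\<close>.\<close>
      have "{t \<in> S. u \<le> t} \<subseteq> supp V s (L x)"
      proof
        fix t assume t: "t \<in> {t \<in> S. u \<le> t}"
        then have "t \<in> V - {0}" "f t \<noteq> ord_zero (s t)" using S by (auto simp: supp_def)
        moreover have "t \<in> T B" using B(2) t \<open>t \<in> V - {0}\<close> by (fastforce simp: T_def)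
        ultimately show "t \<in> supp V s (L x)" using f_eq [OF B(1) _ B(3)] by (simp add: supp_def)
      qed
      moreover have "supp V s (L x) \<in> Well V"
        using L_in B BM by (auto simp: model_space_def)
      moreover have "{t \<in> S. u \<le> t} \<noteq> {}" using u by auto
      ultimately obtain m where "m \<in> {t \<in> S. u \<le> t}" "\<And>t. t \<in> {t \<in> S. u \<le> t} \<Longrightarrow> t \<le> m"
        by (rule WellD) (rule that)
      then have "m \<in> S" "u \<le> m" "\<And>t. t \<in> S \<Longrightarrow> u \<le> t \<Longrightarrow> t \<le> m" by auto
      then show "\<exists>m\<in>S. \<forall>t\<in>S. t \<le> m" by (meson linear order_trans)
    qed
    ultimately show ?thesis
      by (auto simp: model_space_def f_def)
  qed
  then obtain w where w: "w \<in> M" "L w = f" using L unfolding isometry_onto_def by (metis imageE)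
  have "w \<in> B" if B: "B \<in> \<C>" for B
  proof -
    obtain x where x: "x \<in> B" using B \<C> by blast
    then have xM: "x \<in> M" using BM B by blast
    show ?thesis
    proof (cases "L x = f")
      case True
      then have "d x w = 0" using L_dist [OF xM w(1)] w by (simp add: model_dist_def)
      then show ?thesis using x xM w by simp
    next
      case False
      then obtain m where m: "m \<in> V - {0}" "L x m \<noteq> f m" "model_dist V (L x) f = m"
        using model_space_greatest_difference [OF L_in [OF xM] \<open>f \<in> model_space V s\<close>] by metis
      \<comment> \<open>A disagreement at \<open>m = d x w\<close> means that \<open>B\<close> does
        not determine coordinate \<open>m\<close>; hence \<open>B\<close> contains two points at
        least that far apart, and \<open>w\<close> belongs to it.\<close>
      then have "m \<notin> T B" using f_eq [OF B _ x] by metis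
      then obtain y z where "y \<in> B" "z \<in> B" "m \<le> d y z" using m(1) by (auto simp: T_def not_less)
      moreover have "d x w = m" using L_dist [OF xM w(1)] w m by simp
      ultimately show ?thesis using balls_memI [of B x y z w] x w \<C> B by auto
    qed
  qed
  then show "M \<inter> \<Inter>\<C> \<noteq> {}" using w by auto
qed

lemma isometric_to_model_imp:
  assumes "isometric_to_model TYPE('b) M d"
  shows "T_complete \<and> homogeneous"
  using assms model_imp_T_complete model_imp_homogeneous
  unfolding isometric_to_model_def isometric_def by blast

section \<open>Coordinates from labelled sons under condition h\<close>

lemma T_complete_condition_h_imp_model:
  assumes "M \<noteq> {}" T_complete condition_h
  shows "isometric_to_model TYPE('a) M d"
proof -
  obtain a0 where a0: "a0 \<in> M" using assms by blast
  define V where "V = Spec a0"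
  have Spec: "Spec x = V" if "x \<in> M" for x
    using assms(3) a0 that unfolding condition_h_def condition_h1_def V_def by blast
  have V0: "r \<ge> 0" if "r \<in> V" for r using that by (auto simp: V_def Spec_def)
  have dV: "d x y \<in> V" if "x \<in> M" "y \<in> M" for x y
    using that Spec [of x] by (auto simp: Spec_def)
  define V' where "V' = V - {0}"
  have pos: "r > 0" if "r \<in> V'" for r using V0 that by (fastforce simp: V'_def)
  have Spec': "r \<in> Spec x" if "r \<in> V'" "x \<in> M" for r x using Spec that by (simp add: V'_def)

  \<comment> \<open>There are at most as many sons as points in the ball, so a set of points can
    serve as the set of labels.\<close>
  have "\<exists>R :: 'a set. |Sons (mcball a0 r)| =o |R|" if "r \<in> V'" for r
  proof -
    have "|Sons (mcball a0 r)| \<le>o |mcball a0 r|"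
      using that a0 by (simp add: Sons_mcball Spec' pos card_of_image)
    then show ?thesis using internalize_card_of_ordLeq2 [of "Sons (mcball a0 r)" "mcball a0 r"] by blast
  qed
  then obtain R :: "real \<Rightarrow> 'a set" where R: "\<And>r. r \<in> V' \<Longrightarrow> |Sons (mcball a0 r)| =o |R r|"
    by metis
  define s where "s r = |R r|" for r
  have Sons_card: "|Sons (mcball x r)| =o |R r|" if "x \<in> M" "r \<in> V'" for x r
  proof -
    have "mcball x r \<in> Nerv" "mcball a0 r \<in> Nerv" using a0 that Spec' by (auto simp: Nerv_def)
    then have "|Sons (mcball x r)| =o |Sons (mcball a0 r)|"
      using assms(3) a0 that unfolding condition_h_def condition_h2_def
      by (auto simp: mdiameter_mcball Spec' pos)
    then show ?thesis using R [OF that(2)] ordIso_transitive by blast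
  qed

  text \<open>The label \<open>0\<close> goes to the son containing the least element of the ball with respect to
    a well-order of the whole type. Along an increasing sequence of balls around \<open>x\<close> the least
    elements descend, strictly so at the radii where \<open>x\<close> is not in the son labelled \<open>0\<close>.\<close>
  define \<mu> where "\<mu> B = wo_rel.minim |UNIV :: 'a set| B" for B
  have wo: "wo_rel |UNIV :: 'a set|" by (simp add: wo_rel_def card_of_Well_order)
  have \<mu>_in: "\<mu> B \<in> B" if "B \<noteq> {}" for B
    unfolding \<mu>_def using that by (intro wo_rel.minim_in [OF wo]) (auto simp: Field_card_of)
  have \<mu>_least: "(\<mu> B, b) \<in> |UNIV|" if "b \<in> B" for B b
    unfolding \<mu>_def using that by (intro wo_rel.minim_least [OF wo]) (auto simp: Field_card_of)
  have antisym: "p = q" if "(p, q) \<in> |UNIV :: 'a set|" "(q, p) \<in> |UNIV|" for p q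
    using wo_rel.ANTISYM [OF wo] that by (auto simp: antisym_def)

  have "\<exists>\<beta>. bij_betw \<beta> (Sons (mcball x r)) (R r) \<and>
      \<beta> (mball (\<mu> (mcball x r)) r) = ord_zero (s r)" if x: "x \<in> M" and r: "r \<in> V'" for x r
  proof -
    obtain \<beta> where \<beta>: "bij_betw \<beta> (Sons (mcball x r)) (R r)"
      using Sons_card [OF x r] card_of_ordIso by blast
    have "x \<in> mcball x r" using x pos [OF r] by simp
    then have "\<mu> (mcball x r) \<in> mcball x r" by (intro \<mu>_in) (metis empty_iff)
    then have son: "mball (\<mu> (mcball x r)) r \<in> Sons (mcball x r)"
      unfolding Sons_mcball [OF x Spec' [OF r x] pos [OF r]] by (rule imageI)
    then have "R r \<noteq> {}" using \<beta> by (auto simp: bij_betw_def)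
    then have "ord_zero (s r) \<in> R r"
      using ord_zero_in_Field [of "s r"] by (simp add: s_def Field_card_of card_of_card_order_on)
    with \<beta> son show ?thesis by (meson bij_betw_prescribe_value)
  qed
  \<comment> \<open>The labelling is chosen for the ball \<open>B\<close> as a set, so that all its
    centres share it.\<close>
  then have "\<exists>\<beta>. bij_betw \<beta> (Sons B) (R r) \<and> \<beta> (mball (\<mu> B) r) = ord_zero (s r)"
    if "\<exists>x\<in>M. B = mcball x r" "r \<in> V'" for B r using that by blast
  then obtain \<beta> where \<beta>': "\<And>B r. \<exists>x\<in>M. B = mcball x r \<Longrightarrow> r \<in> V' \<Longrightarrow>
      bij_betw (\<beta> B r) (Sons B) (R r) \<and> \<beta> B r (mball (\<mu> B) r) = ord_zero (s r)"
    by metis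
  have \<beta>: "bij_betw (\<beta> (mcball x r) r) ((\<lambda>x. mball x r) ` mcball x r) (R r)"
    "\<beta> (mcball x r) r (mball (\<mu> (mcball x r)) r) = ord_zero (s r)" if "x \<in> M" "r \<in> V'" for x r
    using \<beta>' [of "mcball x r" r] that by (auto simp: Sons_mcball Spec' pos)
  define L where "L x = (\<lambda>r\<in>V'. \<beta> (mcball x r) r (mball x r))" for x

  have L_in_R: "L x r \<in> R r" if "x \<in> M" "r \<in> V'" for x r
    using that \<beta>(1) [OF that] pos [of r] by (auto simp: L_def bij_betw_def)
  \<comment> \<open>At distance at most \<open>r\<close>, both points have the same closed ball of
    radius \<open>r\<close>, hence the same injective labelling of its sons.\<close>
  have L_eq_iff: "L x r = L y r \<longleftrightarrow> d x y < r"
    if "x \<in> M" "y \<in> M" "r \<in> V'" "d x y \<le> r" for x y r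
  proof -
    have eq: "mcball y r = mcball x r"
      using that mcball_eq_iff [of x y r] pos [of r] by auto
    have "inj_on (\<beta> (mcball x r) r) ((\<lambda>x. mball x r) ` mcball x r)"
      using \<beta>(1) that by (auto simp: bij_betw_def)
    moreover have "mball z r \<in> (\<lambda>x. mball x r) ` mcball x r" if "z \<in> mcball x r" for z
      using that by (rule imageI)
    moreover have "x \<in> mcball x r" "y \<in> mcball x r" using that pos [of r] by auto
    ultimately have "\<beta> (mcball x r) r (mball x r) = \<beta> (mcball x r) r (mball y r)
        \<longleftrightarrow> mball x r = mball y r"
      using inj_on_eq_iff by metis
    then have "L x r = L y r \<longleftrightarrow> mball x r = mball y r"
      using that(3) by (simp add: L_def eq)
    then show ?thesis using that mball_eq_iff pos by metis
  qed
  have L_surj: "\<exists>y\<in>mcball x r. L y r = c" if xrc: "x \<in> M" "r \<in> V'" "c \<in> R r" for x r c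
  proof -
    have "c \<in> \<beta> (mcball x r) r ` (\<lambda>x. mball x r) ` mcball x r"
      using \<beta>(1) [OF xrc(1,2)] xrc(3) by (simp add: bij_betw_def)
    then obtain y where y: "y \<in> mcball x r" "c = \<beta> (mcball x r) r (mball y r)"
      by (elim imageE) (simp only: that)
    then have "mcball y r = mcball x r"
      using xrc mcball_eq_iff [of x y r] pos [of r] by auto
    then have "L y r = c" using y(2) xrc(2) by (simp add: L_def)
    then show ?thesis using y(1) by blast
  qed

  have L_in: "L x \<in> model_space V s" if x: "x \<in> M" for x
  proof -
    \<comment> \<open>A nonzero label puts \<open>x\<close> and the least element of the ball in
      different sons, hence at distance exactly \<open>r\<close>.\<close>
    have far: "d x (\<mu> (mcball x r)) = r" if "r \<in> supp V s (L x)" for r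
    proof -
      have r: "r \<in> V'" and ne: "L x r \<noteq> ord_zero (s r)" using that by (auto simp: supp_def V'_def)
      have "x \<in> mcball x r" using x pos [OF r] by simp
      then have "\<mu> (mcball x r) \<in> mcball x r" by (intro \<mu>_in) (metis empty_iff)
      moreover have "mball x r \<noteq> mball (\<mu> (mcball x r)) r"
        using ne \<beta>(2) [OF x r] r by (auto simp: L_def)
      ultimately show ?thesis using mball_eq_iff [of x _ r] pos [OF r] x by fastforce
    qed
    have "supp V s (L x) \<in> Well V"
      unfolding Well_def
    proof (intro CollectI conjI allI impI)
      show "supp V s (L x) \<subseteq> V - {0}" by (auto simp: supp_def)
      fix S assume S: "S \<subseteq> supp V s (L x)" "S \<noteq> {}"
      define K where "K = (\<lambda>r. \<mu> (mcball x r)) ` S"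
      \<comment> \<open>The maximum of \<open>S\<close> is the radius whose ball has the smallest
        least element: a larger radius in \<open>S\<close> would give the same least element, and by
        \<open>far\<close> the same radius.\<close>
      have "\<mu> K \<in> K" using S by (intro \<mu>_in) (simp add: K_def)
      then obtain m where m: "m \<in> S" "\<mu> K = \<mu> (mcball x m)" by (auto simp: K_def)
      have "t \<le> m" if t: "t \<in> S" for t
      proof (rule ccontr)
        assume "\<not> t \<le> m"
        have "m \<in> V'" using m S by (auto simp: supp_def V'_def)
        then have "x \<in> mcball x m" using x pos [of m] by simp
        then have "\<mu> (mcball x m) \<in> mcball x m" by (intro \<mu>_in) (metis empty_iff)
        then have "\<mu> (mcball x m) \<in> mcball x t" using \<open>\<not> t \<le> m\<close> by auto
        then have "(\<mu> (mcball x t), \<mu> (mcball x m)) \<in> |UNIV|" by (rule \<mu>_least)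
        moreover have "(\<mu> (mcball x m), \<mu> (mcball x t)) \<in> |UNIV|"
          unfolding m(2) [symmetric] using t by (intro \<mu>_least) (simp add: K_def)
        ultimately have "\<mu> (mcball x t) = \<mu> (mcball x m)" by (rule antisym)
        then have "t = m" using far [of t] far [of m] t m S by auto
        then show False using \<open>\<not> t \<le> m\<close> by simp
      qed
      then show "\<exists>m\<in>S. \<forall>t\<in>S. t \<le> m" using m by blast
    qed
    moreover have "L x \<in> (\<Pi>\<^sub>E r\<in>V - {0}. Field (s r))"
      using L_in_R [OF x] by (auto simp: s_def Field_card_of L_def V'_def)
    ultimately show ?thesis by (simp add: model_space_def)
  qed
  have L_dist: "model_dist V (L x) (L y) = d x y" if xy: "x \<in> M" "y \<in> M" for x y
  proof (cases "x = y")
    case True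
    then show ?thesis using xy by (simp add: model_dist_def)
  next
    case False
    then have "d x y \<in> V'" using dV xy by (simp add: V'_def)
    then have "L x (d x y) \<noteq> L y (d x y)" using L_eq_iff xy by simp
    moreover have "L x t = L y t" if "t \<in> V'" "d x y < t" for t using L_eq_iff xy that by simp
    ultimately show ?thesis using \<open>d x y \<in> V'\<close> by (intro model_dist_eqI) (auto simp: V'_def)
  qed

  have "\<exists>x\<in>M. L x = f" if f: "f \<in> model_space V s" for f
  proof -
    \<comment> \<open>\<open>D r\<close> collects the points whose coordinates agree with
      \<open>f\<close> from \<open>r\<close> upwards; \<open>U\<close> holds the radii where such
      points exist.\<close>
    define D where "D r = {x \<in> M. \<forall>t\<in>V'. r \<le> t \<longrightarrow> L x t = f t}" for r
    define U where "U = {r \<in> V'. D r \<noteq> {}}"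
    have D_ball: "D r \<in> balls - {{}}" if r: "r \<in> U" for r
    proof -
      obtain x where x: "x \<in> D r" using r by (auto simp: U_def)
      then have xM: "x \<in> M" by (simp add: D_def)
      have rV: "r \<in> V'" using r by (simp add: U_def)
      have "y \<in> D r \<longleftrightarrow> d x y < r" if y: "y \<in> M" for y
      proof
        assume "y \<in> D r"
        then have eq: "L x t = L y t" if "t \<in> V'" "r \<le> t" for t using x that by (simp add: D_def)
        show "d x y < r"
        proof (rule ccontr)
          assume "\<not> d x y < r"
          \<comment> \<open>Otherwise the coordinate \<open>d x y\<close>, which is at least
            \<open>r\<close>, would separate \<open>x\<close> from \<open>y\<close>.\<close>
          then have "d x y \<in> V'" using pos [OF rV] dV [OF xM y] by (auto simp: V'_def)
          then show False using eq L_eq_iff [OF xM y] \<open>\<not> d x y < r\<close> by fastforce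
        qed
      next
        assume "d x y < r"
        then have "L x t = L y t" if "t \<in> V'" "r \<le> t" for t using L_eq_iff [OF xM y] that by simp
        then show "y \<in> D r" using x y by (simp add: D_def)
      qed
      moreover have "D r \<subseteq> M" by (auto simp: D_def)
      ultimately have "D r = mball x r" using xM by (auto simp only: in_mball)
      then show ?thesis using x xM pos [OF rV] by (auto simp: balls_def intro: less_imp_le)
    qed
    have D_mono: "D r \<subseteq> D r'" if "r \<le> r'" for r r' using that by (auto simp: D_def)
    have "chain\<^sub>\<subseteq> (D ` U)" unfolding chain_subset_def
      using D_mono by (metis imageE linear)
    moreover have "D ` U \<subseteq> balls - {{}}" using D_ball by blast
    ultimately have "M \<inter> \<Inter>(D ` U) \<noteq> {}" using assms(2) unfolding T_complete_def by blast
    then obtain x where x: "x \<in> M" "\<And>r. r \<in> U \<Longrightarrow> x \<in> D r" by blast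
    have "L x = f"
    proof (rule ccontr)
      assume "L x \<noteq> f"
      then obtain m where m: "m \<in> V - {0}" "L x m \<noteq> f m"
        "\<And>t. t \<in> V - {0} \<Longrightarrow> m < t \<Longrightarrow> L x t = f t"
        using model_space_greatest_difference [OF L_in [OF x(1)] f] by metis
      have mV: "m \<in> V'" using m(1) by (simp add: V'_def)
      have "f m \<in> R m" using f m(1) by (auto simp: model_space_def s_def Field_card_of)
      \<comment> \<open>Changing the label at the largest disagreement \<open>m\<close> yields a
        point \<open>y\<close> agreeing with \<open>f\<close> from \<open>m\<close> upwards; so
        \<open>m\<close> is in \<open>U\<close> and \<open>x\<close> in \<open>D m\<close>, a
        contradiction.\<close>
      then obtain y where y: "y \<in> mcball x m" "L y m = f m" using L_surj [OF x(1) mV] by blast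
      then have yM: "y \<in> M" and "d x y \<le> m" by auto
      have "L y t = f t" if "t \<in> V'" "m < t" for t
        using L_eq_iff [OF x(1) yM, of t] that \<open>d x y \<le> m\<close> m(3) [of t] by (simp add: V'_def)
      then have "L y t = f t" if "t \<in> V'" "m \<le> t" for t
        using that y(2) by (cases "m = t") auto
      then have "y \<in> D m" using yM by (simp add: D_def)
      then have "x \<in> D m" using mV by (intro x(2)) (auto simp: U_def)
      then show False using m(2) mV by (simp add: D_def)
    qed
    then show ?thesis using x(1) by blast
  qed
  then have "isometry_onto M d (model_space V s) (model_dist V) L"
    using L_in L_dist by (auto simp: isometry_onto_def)
  moreover have "admissible V s"
    unfolding admissible_def
  proof (intro conjI ballI)
    show "V \<subseteq> {0..}" using V0 by auto
    show "0 \<in> V" using dV [OF a0 a0] a0 by simp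
    fix r assume "r \<in> V - {0}"
    then have r: "r \<in> V'" by (simp add: V'_def)
    show c: "Card_order (s r)" by (simp add: s_def card_of_Card_order)
    obtain b where b: "b \<in> M" "d a0 b = r" using Spec' [OF r a0] by (auto simp: Spec_def)
    \<comment> \<open>Two points at distance exactly \<open>r\<close> supply two distinct
      labels.\<close>
    then have "L a0 r \<noteq> L b r" using L_eq_iff [OF a0 _ r] by simp
    then show "ctwo \<le>o s r"
      unfolding ctwo_ordLeq_iff [OF c] using L_in_R [OF _ r] a0 b by (auto simp: s_def Field_card_of)
  qed
  ultimately show ?thesis by (auto simp: isometric_to_model_def isometric_def)
qed

end

theorem theorem6:
  fixes M :: "'a set" and d :: "'a \<Rightarrow> 'a \<Rightarrow> real"
  assumes "Ultrametric_space M d" and "M \<noteq> {}"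
  shows
    "(Metric_space.T_complete M d \<and> Metric_space.homogeneous M d \<longleftrightarrow>
      Metric_space.T_complete M d \<and> Metric_space.condition_h M d)
   \<and> (Metric_space.T_complete M d \<and> Metric_space.homogeneous M d \<longleftrightarrow>
      isometric_to_model TYPE('a) M d)
   \<and> (isometric_to_model TYPE('b) M d \<longrightarrow>
      Metric_space.T_complete M d \<and> Metric_space.homogeneous M d)"
proof -
  interpret Ultrametric_space M d by fact
  have "T_complete \<and> homogeneous" if "isometric_to_model TYPE('a) M d"
    using that isometric_to_model_imp by blast
  moreover have "T_complete \<and> homogeneous" if "isometric_to_model TYPE('b) M d"
    using that isometric_to_model_imp by blast
  ultimately show ?thesis
    using homogeneous_imp_condition_h T_complete_condition_h_imp_model [OF assms(2)] by blast
qed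

end
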